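(* Let $Y$ be a homogeneous continuum which is filament additive and filamentable, and all of whose filament composants are dense in $Y$. Then $Y$ is indecomposable if and only if every filament composant of $Y$ is indecomposable (as a connected space).
   Context: A continuum is a connected compact metrizable space with more than one point. A subcontinuum of a continuum $Y$ is a non-empty compact connected subset of $Y$ (one-point subsets are allowed). A connected space $X$ (in particular, a continuum) is indecomposable if $X$ cannot be written as the union of two proper closed connected subsets. $Y$ is homogeneous if for every two points $x,y\in Y$ there is a homeomorphism of $Y$ onto itself mapping $x$ to $y$. A subcontinuum $K$ of $Y$ is filament if there is a neighborhood $N$ of $K$ in $Y$ (a set whose interior contains $K$) such that the connected component of $N$ containing $K$ is nowhere dense in $Y$. The filament composant of $x\in Y$ is the union of all filament subcontinua of $Y$ containing $x$. A subset $X\subseteq Y$ is a filament set if every subcontinuum of $Y$ contained in $X$ is filament. $Y$ is filament additive if the union of every two intersecting filament subcontinua of $Y$ is filament. $Y$ is filamentable if there is a filament subcontinuum $L\subseteq Y$ such that $Y\setminus L$ is a filament set. *)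

theory Defs
  imports "HOL-Analysis.Abstract_Metric_Spaces"
begin

definition continuum :: "'a topology \<Rightarrow> bool" where
  "continuum Y \<longleftrightarrow> connected_space Y \<and> compact_space Y \<and> metrizable_space Y \<and>
     (\<exists>x \<in> topspace Y. \<exists>y \<in> topspace Y. x \<noteq> y)"

definition subcontinuum :: "'a topology \<Rightarrow> 'a set \<Rightarrow> bool" where
  "subcontinuum Y K \<longleftrightarrow> K \<noteq> {} \<and> compactin Y K \<and> connectedin Y K"

definition indecomposable_space :: "'a topology \<Rightarrow> bool" where
  "indecomposable_space X \<longleftrightarrow> connected_space X \<and>
     \<not> (\<exists>A B. closedin X A \<and> connectedin X A \<and> A \<noteq> topspace X \<and>
              closedin X B \<and> connectedin X B \<and> B \<noteq> topspace X \<and>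
              A \<union> B = topspace X)"

definition homogeneous_space :: "'a topology \<Rightarrow> bool" where
  "homogeneous_space Y \<longleftrightarrow>
     (\<forall>x \<in> topspace Y. \<forall>y \<in> topspace Y. \<exists>h. homeomorphic_map Y Y h \<and> h x = y)"

definition nowhere_dense_in :: "'a topology \<Rightarrow> 'a set \<Rightarrow> bool" where
  "nowhere_dense_in Y S \<longleftrightarrow> S \<subseteq> topspace Y \<and> Y interior_of (Y closure_of S) = {}"

definition dense_in :: "'a topology \<Rightarrow> 'a set \<Rightarrow> bool" where
  "dense_in Y S \<longleftrightarrow> S \<subseteq> topspace Y \<and> Y closure_of S = topspace Y"

(* A nonempty connected K inside N lies in exactly one component C of N, so the
   existential over C selects the component of N containing K. *)
definition filament :: "'a topology \<Rightarrow> 'a set \<Rightarrow> bool" where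
  "filament Y K \<longleftrightarrow> subcontinuum Y K \<and>
     (\<exists>N. N \<subseteq> topspace Y \<and> K \<subseteq> Y interior_of N \<and>
       (\<exists>C \<in> connected_components_of (subtopology Y N). K \<subseteq> C \<and> nowhere_dense_in Y C))"

definition filament_composant :: "'a topology \<Rightarrow> 'a \<Rightarrow> 'a set" where
  "filament_composant Y x = \<Union> {K. filament Y K \<and> x \<in> K}"

definition filament_set :: "'a topology \<Rightarrow> 'a set \<Rightarrow> bool" where
  "filament_set Y X \<longleftrightarrow> X \<subseteq> topspace Y \<and> (\<forall>K. subcontinuum Y K \<and> K \<subseteq> X \<longrightarrow> filament Y K)"

definition filament_additive :: "'a topology \<Rightarrow> bool" where
  "filament_additive Y \<longleftrightarrow>
     (\<forall>K L. filament Y K \<and> filament Y L \<and> K \<inter> L \<noteq> {} \<longrightarrow> filament Y (K \<union> L))"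

definition filamentable :: "'a topology \<Rightarrow> bool" where
  "filamentable Y \<longleftrightarrow> (\<exists>L. filament Y L \<and> filament_set Y (topspace Y - L))"

end

theory Submission
  imports Defs
begin

text \<open>
  Filament composants are connected and dense, so the closures of the pieces of a decomposition
  of a composant decompose \<open>Y\<close>. Conversely, let \<open>Y = A \<union> B\<close> with \<open>A\<close>, \<open>B\<close> proper subcontinua,
  let \<open>L\<close> be filament with \<open>Y - L\<close> a filament set, and let \<open>F\<close> be the filament composant of a
  point of \<open>L\<close>. As \<open>A\<close> has interior, it is not filament and so meets \<open>L\<close>. By boundary
  bumping, the subcontinua of \<open>A - L\<close> through a point of \<open>A \<inter> F\<close> accumulate on \<open>L\<close>; they are
  filament, hence contained in \<open>F\<close> by additivity, which makes \<open>(A \<inter> F) \<union> L\<close> connected. So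
  \<open>(A \<inter> F) \<union> L\<close> and \<open>(B \<inter> F) \<union> L\<close> decompose \<open>F\<close>; they are proper because \<open>F\<close> is dense and \<open>L\<close>
  is nowhere dense.
\<close>

text \<open>If the closure missed \<open>L\<close>, normality would put an open \<open>V\<close>
  around \<open>L\<close> whose closure misses it too. The component of \<open>y\<close> in the
  complement of \<open>V\<close> avoids \<open>L\<close>, so it is one of the continua in the union;
  yet boundary bumping makes it touch the frontier of \<open>V\<close>.\<close>

lemma closure_of_Union_subcontinua_meets:
  assumes X: "connected_space X" "compact_space X" "Hausdorff_space X"
    and L: "closedin X L" "L \<noteq> {}" and y: "y \<in> topspace X - L"
  shows "X closure_of \<Union>{K. subcontinuum X K \<and> y \<in> K \<and> K \<inter> L = {}} \<inter> L \<noteq> {}"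
proof
  define E where "E = \<Union>{K. subcontinuum X K \<and> y \<in> K \<and> K \<inter> L = {}}"
  assume "X closure_of \<Union>{K. subcontinuum X K \<and> y \<in> K \<and> K \<inter> L = {}} \<inter> L = {}"
  then have disj: "X closure_of E \<inter> L = {}"
    by (simp add: E_def)
  have "subcontinuum X {y}"
    using y by (simp add: subcontinuum_def)
  then have yE: "y \<in> E"
    using y by (auto simp: E_def)
  have Esub: "E \<subseteq> topspace X"
    using connectedin_subset_topspace by (fastforce simp: E_def subcontinuum_def)
  have "normal_space X"
    using X compact_Hausdorff_or_regular_imp_normal_space by blast
  moreover have "openin X (topspace X - X closure_of E)" "L \<subseteq> topspace X - X closure_of E"
    using disj closedin_subset[OF L(1)] by auto
  ultimately obtain V where V: "openin X V" "L \<subseteq> V" "X closure_of V \<subseteq> topspace X - X closure_of E"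
    using L(1) unfolding normal_space_alt by meson
  define S where "S = topspace X - V"
  have "V \<subseteq> X closure_of V" "E \<subseteq> X closure_of E"
    using V(1) Esub by (auto intro!: closure_of_subset openin_subset)
  then have yS: "y \<in> S"
    using y yE V(3) unfolding S_def by blast
  have cS: "closedin X S" and S: "S \<noteq> topspace X"
    using V L openin_subset[OF V(1)] by (auto simp: S_def)
  have S_sub: "S \<subseteq> topspace X"
    by (auto simp: S_def)
  define C where "C = connected_component_of_set (subtopology X S) y"
  have C: "C \<in> connected_components_of (subtopology X S)"
    using yS S_sub by (auto simp: C_def connected_components_of_def)
  have "closedin X C"
    using closedin_trans_full[OF closedin_connected_components_of[OF C] cS] .
  then have "compactin X C"
    by (simp add: X closedin_compact_space)
  moreover have "connectedin X C" "C \<subseteq> S"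
    using connectedin_connected_components_of[OF C] by (auto simp: connectedin_subtopology)
  moreover have "y \<in> C"
    using yS S_sub by (auto simp: C_def connected_component_of_refl)
  ultimately have "C \<subseteq> E"
    using V(2) unfolding E_def S_def subcontinuum_def by blast
  moreover have "C \<inter> X frontier_of S \<noteq> {}"
    using boundary_bumping_theorem_closed[OF X cS S C] .
  moreover have "X frontier_of S \<subseteq> X closure_of V"
    unfolding S_def frontier_of_complement by (auto simp: frontier_of_def)
  ultimately show False
    using V(3) closure_of_subset[OF Esub] by blast
qed

lemma subcontinuum_subtopology:
  "subcontinuum (subtopology Y A) K \<longleftrightarrow> subcontinuum Y K \<and> K \<subseteq> A"
  by (auto simp: subcontinuum_def compactin_subtopology connectedin_subtopology)

text \<open>\<open>A \<inter> F\<close> alone may be disconnected; \<open>L\<close> serves as glue.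
  Each point of \<open>A \<inter> F - L\<close> lies in a connected subset of
  \<open>A \<inter> F\<close> whose closure reaches \<open>L\<close>.\<close>

lemma connectedin_Int_Un_if_absorbs_subcontinua:
  assumes Y: "compact_space Y" "Hausdorff_space Y"
    and A: "closedin Y A" "connectedin Y A" "A \<inter> L \<noteq> {}"
    and L: "closedin Y L" "connectedin Y L"
    and F: "\<And>K. \<lbrakk>subcontinuum Y K; K \<subseteq> A - L; K \<inter> F \<noteq> {}\<rbrakk> \<Longrightarrow> K \<subseteq> F"
  shows "connectedin Y (A \<inter> F \<union> L)"
proof -
  define E where
    "E y = \<Union>{K. subcontinuum (subtopology Y A) K \<and> y \<in> K \<and> K \<inter> (A \<inter> L) = {}}" for y
  have A_sub: "A \<subseteq> topspace Y"
    using A(1) closedin_subset by blast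
  have con: "connectedin Y (E y \<union> L)" and yE: "y \<in> E y" and EF: "E y \<subseteq> A \<inter> F"
    if y: "y \<in> A \<inter> F - L" for y
  proof -
    have "subcontinuum (subtopology Y A) {y}"
      using y A_sub by (auto simp: subcontinuum_def)
    then show "y \<in> E y"
      using y by (auto simp: E_def)
    have "connectedin Y (E y)"
      unfolding E_def by (rule connectedin_Union) (auto simp: subcontinuum_def connectedin_subtopology)
    \<comment> \<open>The bumping lemma is applied inside the continuum \<open>A\<close>, with
      \<open>A \<inter> L\<close> as the closed set, so that the continua through \<open>y\<close>
      stay in \<open>A\<close>.\<close>
    moreover have "subtopology Y A closure_of E y \<inter> (A \<inter> L) \<noteq> {}"
      unfolding E_def
    proof (rule closure_of_Union_subcontinua_meets)
      show "connected_space (subtopology Y A)"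
        using A(2) by (simp add: connectedin_def)
      show "compact_space (subtopology Y A)"
        by (simp add: A(1) Y(1) closedin_compact_space compact_space_subtopology)
      show "Hausdorff_space (subtopology Y A)"
        by (simp add: Hausdorff_space_subtopology Y(2))
      show "closedin (subtopology Y A) (A \<inter> L)"
        by (simp add: L(1) closedin_subtopology_Int_closed)
    qed (use y A_sub A(3) in auto)
    then have "Y closure_of E y \<inter> L \<noteq> {}"
      using closure_of_subtopology_subset[of Y A "E y"] by blast
    then have "\<not> separatedin Y (E y) L"
      by (auto simp: separatedin_def)
    ultimately show "connectedin Y (E y \<union> L)"
      using L(2) connectedin_nonseparated_union by blast
    have "K \<subseteq> F" if "subcontinuum Y K" "K \<subseteq> A" "y \<in> K" "K \<inter> (A \<inter> L) = {}" for K
      by (rule F) (use that y in auto)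
    then show "E y \<subseteq> A \<inter> F"
      unfolding E_def subcontinuum_subtopology by blast
  qed
  \<comment> \<open>All members contain the nonempty set \<open>L\<close>; listing \<open>L\<close>
    itself covers the case that \<open>A \<inter> F - L\<close> is empty.\<close>
  let ?\<U> = "insert L ((\<lambda>y. E y \<union> L) ` (A \<inter> F - L))"
  have "\<Union>?\<U> = A \<inter> F \<union> L"
  proof
    show "\<Union>?\<U> \<subseteq> A \<inter> F \<union> L"
      using EF by (intro Union_least) auto
    show "A \<inter> F \<union> L \<subseteq> \<Union>?\<U>"
      using yE by auto
  qed
  moreover have "connectedin Y (\<Union>?\<U>)"
    by (rule connectedin_Union) (use con L(2) A(3) in auto)
  ultimately show ?thesis
    by simp
qed

text \<open>\<open>K\<close> sits in a component that is nowhere dense. This serves both to show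
  that sets with interior are not filament and that \<open>L\<close> cannot fill the complement of a
  proper closed set.\<close>

lemma filament_interior_of_eq_empty:
  assumes "filament Y K"
  shows "Y interior_of K = {}"
proof -
  obtain C where C: "K \<subseteq> C" "nowhere_dense_in Y C"
    using assms by (auto simp: filament_def)
  then have "K \<subseteq> Y closure_of C"
    using closure_of_subset unfolding nowhere_dense_in_def by blast
  with C(2) show ?thesis
    using interior_of_mono unfolding nowhere_dense_in_def by blast
qed

lemma filament_absorbed_by_composant:
  assumes "filament_additive Y" "filament Y K" "K \<inter> filament_composant Y x \<noteq> {}"
  shows "K \<subseteq> filament_composant Y x"
proof -
  obtain M where M: "filament Y M" "x \<in> M" "K \<inter> M \<noteq> {}"
    using assms(3) by (auto simp: filament_composant_def)
  with assms(1,2) have "filament Y (K \<union> M)"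
    by (simp add: filament_additive_def)
  with M(2) show ?thesis
    by (auto simp: filament_composant_def)
qed

lemma connectedin_filament_composant: "connectedin Y (filament_composant Y x)"
proof (cases "filament_composant Y x = {}")
  case False
  then show ?thesis
    unfolding filament_composant_def
    by (intro connectedin_Union) (auto simp: filament_def subcontinuum_def)
qed simp

lemma indecomposable_dense_subspace:
  assumes Y: "indecomposable_space Y" and F: "connectedin Y F" "dense_in Y F"
  shows "indecomposable_space (subtopology Y F)"
proof -
  have top: "topspace (subtopology Y F) = F"
    using F(2) by (auto simp: dense_in_def)
  have False
    if A: "closedin (subtopology Y F) A" "connectedin (subtopology Y F) A" "A \<noteq> F"
      and B: "closedin (subtopology Y F) B" "connectedin (subtopology Y F) B" "B \<noteq> F"
      and AB: "A \<union> B = F" for A B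
  proof -
    \<comment> \<open>A relatively closed \<open>S\<close> is the trace on \<open>F\<close> of its
      closure, so a dense one would be all of \<open>F\<close>.\<close>
    have "Y closure_of S \<noteq> topspace Y"
      if "closedin (subtopology Y F) S" "S \<noteq> F" for S
      using that F(2) by (auto simp: closedin_Int_closure_of dense_in_def)
    moreover have "Y closure_of A \<union> Y closure_of B = topspace Y"
      using F(2) AB by (metis closure_of_Un dense_in_def)
    moreover have "connectedin Y (Y closure_of A)" "connectedin Y (Y closure_of B)"
      using A(2) B(2) by (auto simp: connectedin_subtopology intro: connectedin_closure_of)
    ultimately show False
      using Y A B unfolding indecomposable_space_def by (meson closedin_closure_of)
  qed
  with F(1) show ?thesis
    unfolding indecomposable_space_def top by (auto simp: connectedin_def)
qed

text \<open>Taking \<open>p\<close> in \<open>L\<close> puts \<open>L\<close> inside the composant,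
  so adding \<open>L\<close> to the traces of the two pieces does not leave it.\<close>

lemma decomposable_filament_composant:
  assumes Y: "continuum Y" "filament_additive Y"
    and L: "filament Y L" "filament_set Y (topspace Y - L)" "p \<in> L"
    and dense: "dense_in Y (filament_composant Y p)"
    and dec: "\<not> indecomposable_space Y"
  shows "\<not> indecomposable_space (subtopology Y (filament_composant Y p))"
proof
  define F where "F = filament_composant Y p"
  assume ind: "indecomposable_space (subtopology Y (filament_composant Y p))"
  have cpt: "compact_space Y" and haus: "Hausdorff_space Y"
    using Y(1) metrizable_imp_Hausdorff_space by (auto simp: continuum_def)
  have L': "closedin Y L" "connectedin Y L"
    using L(1) haus compactin_imp_closedin by (auto simp: filament_def subcontinuum_def)
  have LF: "L \<subseteq> F"
    using L(1,3) by (auto simp: F_def filament_composant_def)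
  have F: "F \<subseteq> topspace Y" "Y closure_of F = topspace Y"
    using dense by (auto simp: F_def dense_in_def)
  \<comment> \<open>Stated for an ordered pair, to be used for both \<open>A\<close>,
    \<open>B\<close> and \<open>B\<close>, \<open>A\<close>.\<close>
  have part: "closedin (subtopology Y F) (A \<inter> F \<union> L)" "connectedin (subtopology Y F) (A \<inter> F \<union> L)"
      "A \<inter> F \<union> L \<noteq> F"
    if A: "closedin Y A" "connectedin Y A" "A \<noteq> topspace Y"
      and B: "closedin Y B" "B \<noteq> topspace Y" "A \<union> B = topspace Y" for A B
  proof -
    \<comment> \<open>Otherwise the nonempty open complement of \<open>A\<close> would lie in
      \<open>L\<close>, which has empty interior.\<close>
    have L_or: "A \<union> L \<noteq> topspace Y"
    proof
      assume "A \<union> L = topspace Y"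
      then have "topspace Y - A \<subseteq> Y interior_of L"
        using A(1) by (intro interior_of_maximal) auto
      then show False
        using A closedin_subset[OF A(1)] filament_interior_of_eq_empty[OF L(1)] by blast
    qed
    \<comment> \<open>The complement of \<open>B\<close> gives \<open>A\<close> interior, so
      \<open>A\<close> is not filament and cannot lie in the filament set
      \<open>topspace Y - L\<close>.\<close>
    have "topspace Y - B \<subseteq> Y interior_of A"
      using B by (intro interior_of_maximal) auto
    then have "Y interior_of A \<noteq> {}"
      using B closedin_subset[OF B(1)] by blast
    then have "\<not> filament Y A" "A \<noteq> {}"
      using filament_interior_of_eq_empty by auto
    moreover have "subcontinuum Y A"
      using A \<open>A \<noteq> {}\<close> cpt by (simp add: subcontinuum_def closedin_compact_space)
    ultimately have AL: "A \<inter> L \<noteq> {}"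
      using L(2) closedin_subset[OF A(1)] unfolding filament_set_def by blast
    have "connectedin Y (A \<inter> F \<union> L)"
    proof (rule connectedin_Int_Un_if_absorbs_subcontinua[OF cpt haus A(1,2) AL L'])
      fix K assume K: "subcontinuum Y K" "K \<subseteq> A - L" "K \<inter> F \<noteq> {}"
      then have "filament Y K"
        using L(2) closedin_subset[OF A(1)] unfolding filament_set_def by blast
      with K(3) show "K \<subseteq> F"
        unfolding F_def using filament_absorbed_by_composant[OF Y(2)] by blast
    qed
    with LF show "connectedin (subtopology Y F) (A \<inter> F \<union> L)"
      by (auto simp: connectedin_subtopology)
    \<comment> \<open>This form exhibits the piece as the trace on \<open>F\<close> of a closed set;
      density of \<open>F\<close> then makes it proper, since \<open>A \<union> L\<close> is not
      everything.\<close>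
    have "A \<inter> F \<union> L = (A \<union> L) \<inter> F"
      using LF by blast
    moreover have cAL: "closedin Y (A \<union> L)"
      using A(1) L'(1) by blast
    ultimately show "closedin (subtopology Y F) (A \<inter> F \<union> L)"
      by (auto simp: closedin_subtopology)
    show "A \<inter> F \<union> L \<noteq> F"
    proof
      assume "A \<inter> F \<union> L = F"
      then have "F \<subseteq> A \<union> L"
        by blast
      then have "topspace Y \<subseteq> A \<union> L"
        using closure_of_minimal[OF _ cAL] F(2) by metis
      then show False
        using L_or closedin_subset[OF cAL] by blast
    qed
  qed
  obtain A B where A: "closedin Y A" "connectedin Y A" "A \<noteq> topspace Y"
    and B: "closedin Y B" "connectedin Y B" "B \<noteq> topspace Y" and AB: "A \<union> B = topspace Y"
    using dec Y(1) by (auto simp: indecomposable_space_def continuum_def)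
  have "topspace (subtopology Y F) = F"
    using F(1) by auto
  moreover have "(A \<inter> F \<union> L) \<union> (B \<inter> F \<union> L) = F"
    using AB F(1) LF by blast
  moreover have "B \<union> A = topspace Y"
    using AB by blast
  ultimately show False
    using ind part[OF A B(1,3) AB] part[OF B A(1,3)]
    unfolding F_def[symmetric] indecomposable_space_def by metis
qed

theorem corollary1p6:
  fixes Y :: "'a topology"
  assumes "continuum Y"
    and "homogeneous_space Y"
    and "filament_additive Y"
    and "filamentable Y"
    and "\<And>x. x \<in> topspace Y \<Longrightarrow> dense_in Y (filament_composant Y x)"
  shows "indecomposable_space Y \<longleftrightarrow>
    (\<forall>x \<in> topspace Y. indecomposable_space (subtopology Y (filament_composant Y x)))"
proof
  assume "indecomposable_space Y"
  then show "\<forall>x \<in> topspace Y. indecomposable_space (subtopology Y (filament_composant Y x))"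
    using assms(5) by (simp add: connectedin_filament_composant indecomposable_dense_subspace)
next
  assume ind: "\<forall>x \<in> topspace Y. indecomposable_space (subtopology Y (filament_composant Y x))"
  obtain L where L: "filament Y L" "filament_set Y (topspace Y - L)"
    using assms(4) by (auto simp: filamentable_def)
  then obtain p where "p \<in> L" "p \<in> topspace Y"
    using compactin_subset_topspace by (fastforce simp: filament_def subcontinuum_def)
  then show "indecomposable_space Y"
    using decomposable_filament_composant[OF assms(1,3) L] assms(5) ind by blast
qed

end
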